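(* Let $X$ be a separable Banach space with $\mathrm{Sz}(X)=\omega_0$. Suppose $p>1$ and $$\sup_{0<\epsilon<1}\epsilon^p\,\mathrm{Sz}(X,\epsilon)<\infty.$$ Then $$\sup_{0<\epsilon<1}\epsilon^p\,\mathrm{Cz}(X,\epsilon)<\infty.$$
   Context: For a weak$^*$-compact $K\subset X^*$ and $\epsilon>0$, $\iota_\epsilon K$ is $K$ minus the union of all weak$^*$-open $V\subset X^*$ with norm-diameter of $V\cap K$ at most $\epsilon$. Put $\iota_\epsilon^0K=K$, $\iota_\epsilon^{\alpha+1}K=\iota_\epsilon\iota_\epsilon^\alpha K$, and $\iota_\epsilon^\alpha K=\bigcap_{\beta<\alpha}\iota_\epsilon^\beta K$ for limit ordinals $\alpha$. $\mathrm{Sz}(X,\epsilon)$ is the least countable ordinal $\alpha$ with $\iota_\epsilon^\alpha B_{X^*}=\emptyset$ ($\omega_1$ if none), where $B_{X^*}$ is the closed unit ball of $X^*$; $\mathrm{Sz}(X)=\sup_{\epsilon>0}\mathrm{Sz}(X,\epsilon)$. $\omega_0$ is the first infinite ordinal; $\mathrm{Sz}(X)=\omega_0$ implies that $\mathrm{Sz}(X,\epsilon)$ is finite for every $\epsilon>0$. For $K$ weak$^*$-compact convex, $\hat\iota_\epsilon K$ is the weak$^*$-closed convex hull of $\iota_\epsilon K$; $\mathrm{Cz}(X,\epsilon)$ is the least $n\in\mathbb N$ with $\hat\iota_\epsilon^{\,n}B_{X^*}=\emptyset$, and $\mathrm{Cz}(X,\epsilon)=\infty$ if there is no such $n$. 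*)

theory Defs
  imports "HOL-Analysis.Analysis"
begin

section \<open>The ordinals up to the first uncountable one\<close>

text \<open>\<^term>\<open>cardSuc natLeq\<close> is a well-order of type \<open>\<omega>\<^sub>1\<close>. Its initial segments (the whole
  field included), ordered by inclusion, form a copy of the set of all ordinals \<open>\<le> \<omega>\<^sub>1\<close>: a countable
  ordinal \<open>\<alpha>\<close> is the initial segment of type \<open>\<alpha>\<close>, and the full segment \<^term>\<open>top\<close> is \<open>\<omega>\<^sub>1\<close>.\<close>

lemma Well_order_cardSuc_natLeq: "Well_order (cardSuc natLeq)"
  by (simp add: cardSuc_Well_order natLeq_Card_order)

lemma wo_rel_cardSuc_natLeq: "wo_rel (cardSuc natLeq)"
  by (simp add: Well_order_cardSuc_natLeq wo_rel_def)

typedef omega1_ord = "{A. ofilter (cardSuc natLeq) A}"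
  morphisms segment Abs_omega1_ord
  by (rule exI[of _ "{}"]) (simp add: Order_Relation.ofilter_def)

setup_lifting type_definition_omega1_ord

lemma segment_subset_Field: "segment a \<subseteq> Field (cardSuc natLeq)"
  using segment[of a] by (simp add: Order_Relation.ofilter_def)

instantiation omega1_ord :: complete_linorder
begin

lift_definition less_eq_omega1_ord :: "omega1_ord \<Rightarrow> omega1_ord \<Rightarrow> bool" is "(\<subseteq>)" .
lift_definition less_omega1_ord :: "omega1_ord \<Rightarrow> omega1_ord \<Rightarrow> bool" is "(\<subset>)" .
lift_definition inf_omega1_ord :: "omega1_ord \<Rightarrow> omega1_ord \<Rightarrow> omega1_ord" is "(\<inter>)"
  by (auto simp: Order_Relation.ofilter_def)
lift_definition sup_omega1_ord :: "omega1_ord \<Rightarrow> omega1_ord \<Rightarrow> omega1_ord" is "(\<union>)"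
  by (auto simp: Order_Relation.ofilter_def)
lift_definition bot_omega1_ord :: omega1_ord is "{}"
  by (auto simp: Order_Relation.ofilter_def)
lift_definition top_omega1_ord :: omega1_ord is "Field (cardSuc natLeq)"
  by (rule wo_rel.Field_ofilter[OF wo_rel_cardSuc_natLeq])
lift_definition Sup_omega1_ord :: "omega1_ord set \<Rightarrow> omega1_ord" is "\<Union>"
  by (auto simp: Order_Relation.ofilter_def) blast
lift_definition Inf_omega1_ord :: "omega1_ord set \<Rightarrow> omega1_ord"
  is "\<lambda>S. \<Inter>S \<inter> Field (cardSuc natLeq)"
  by (auto simp: Order_Relation.ofilter_def under_def Field_def)

instance
proof
  fix x y :: omega1_ord
  show "x \<le> y \<or> y \<le> x"
    using wo_rel.ofilter_linord[OF wo_rel_cardSuc_natLeq] segment[of x] segment[of y]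
    by (simp add: less_eq_omega1_ord.rep_eq)
qed (use segment_subset_Field in
  \<open>auto simp: less_eq_omega1_ord.rep_eq less_omega1_ord.rep_eq inf_omega1_ord.rep_eq
     sup_omega1_ord.rep_eq bot_omega1_ord.rep_eq top_omega1_ord.rep_eq
     Sup_omega1_ord.rep_eq Inf_omega1_ord.rep_eq segment_inject[symmetric]\<close>)

end

instance omega1_ord :: wellorder
proof (rule wf_wellorderI)
  let ?R = "{(x::omega1_ord, y). x < y \<and> y \<noteq> top}"
  let ?S = "{(x::omega1_ord, y). x < y \<and> y = top}"
  have sub: "?R \<subseteq> inv_image (ofilterIncl (cardSuc natLeq)) segment"
  proof clarify
    fix x y :: omega1_ord assume "x < y" "y \<noteq> top"
    then have lt: "segment x \<subset> segment y" by (simp add: less_omega1_ord.rep_eq)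
    have "segment y \<noteq> Field (cardSuc natLeq)"
      using \<open>y \<noteq> top\<close> by (metis segment_inject top_omega1_ord.rep_eq)
    then show "(x, y) \<in> inv_image (ofilterIncl (cardSuc natLeq)) segment"
      using lt segment[of x] segment[of y] segment_subset_Field[of y]
      by (auto simp: ofilterIncl_def)
  qed
  have "wf (inv_image (ofilterIncl (cardSuc natLeq)) segment)"
    by (intro wf_inv_image wf_ofilterIncl Well_order_cardSuc_natLeq)
  then have "wf ?R" using sub by (rule wf_subset)
  moreover have "wf ?S"
    by (rule wf_subset[OF wf_measure[of "\<lambda>x. if x = top then 1 else 0"]])
      (auto simp: measure_def inv_image_def less_than_iff)
  moreover have "Domain ?R \<inter> Range ?S = {}" by auto
  ultimately have "wf (?R \<union> ?S)" by (rule wf_Un)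
  moreover have "?R \<union> ?S = {(x, y). x < y}" by auto
  ultimately show "wf {(x::omega1_ord, y). x < y}" by simp
qed intro_classes

unbundle cardinal_syntax

lemma countable_iff_ordLess_cardSuc: "countable A \<longleftrightarrow> |A| <o cardSuc natLeq"
proof -
  have "|A| <o cardSuc natLeq \<longleftrightarrow> |A| \<le>o natLeq"
    by (rule cardSuc_ordLeq_ordLess) (simp_all add: natLeq_Card_order card_of_Card_order)
  also have "\<dots> \<longleftrightarrow> countable A"
  proof -
    have nat: "|UNIV :: nat set| =o natLeq"
      using card_of_Field_ordIso[OF natLeq_Card_order] by (simp add: Field_natLeq)
    have "countable A \<longleftrightarrow> |A| \<le>o |UNIV :: nat set|"
      by (simp add: countable_def card_of_ordLeq[symmetric])
    also have "\<dots> \<longleftrightarrow> |A| \<le>o natLeq"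
      using ordLeq_ordIso_trans[OF _ nat] ordLeq_ordIso_trans[OF _ ordIso_symmetric[OF nat]]
      by (rule iffI)
    finally show ?thesis ..
  qed
  finally show ?thesis ..
qed

lemma bij_betw_segment:
  "bij_betw (\<lambda>x. Abs_omega1_ord (underS (cardSuc natLeq) x)) (segment a) {..<a}"
proof -
  let ?r = "cardSuc natLeq"
  note wo = wo_rel_cardSuc_natLeq
  have seg: "segment (Abs_omega1_ord (underS ?r x)) = underS ?r x" for x
    by (rule Abs_omega1_ord_inverse) (simp add: wo_rel.underS_ofilter[OF wo])
  have ofa: "ofilter ?r (segment a)" using segment[of a] by simp
  have "inj_on (\<lambda>x. Abs_omega1_ord (underS ?r x)) (segment a)"
  proof (rule inj_onI)
    fix x y assume x: "x \<in> segment a" and y: "y \<in> segment a"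
      and "Abs_omega1_ord (underS ?r x) = Abs_omega1_ord (underS ?r y)"
    then have eq: "underS ?r x = underS ?r y" using seg by metis
    have F: "x \<in> Field ?r" "y \<in> Field ?r" using x y segment_subset_Field by auto
    show "x = y"
    proof (rule ccontr)
      assume ne: "x \<noteq> y"
      then have "(x, y) \<in> ?r \<or> (y, x) \<in> ?r"
        using F wo_rel.TOTAL[OF wo] by (auto simp: total_on_def)
      then have "x \<in> underS ?r y \<or> y \<in> underS ?r x" using ne by (auto simp: underS_def)
      then show False using eq by (auto simp: underS_def)
    qed
  qed
  moreover have "(\<lambda>x. Abs_omega1_ord (underS ?r x)) ` segment a = {..<a}"
  proof (intro equalityI subsetI)
    fix b assume "b \<in> (\<lambda>x. Abs_omega1_ord (underS ?r x)) ` segment a"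
    then obtain x where x: "x \<in> segment a" "b = Abs_omega1_ord (underS ?r x)" by auto
    then have "underS ?r x \<subseteq> segment a"
      using ofa by (auto simp: Order_Relation.ofilter_def underS_def under_def)
    moreover have "x \<notin> underS ?r x" by (simp add: underS_def)
    ultimately show "b \<in> {..<a}" using x seg by (auto simp: less_omega1_ord.rep_eq)
  next
    fix b assume "b \<in> {..<a}"
    then have lt: "segment b \<subset> segment a" by (simp add: less_omega1_ord.rep_eq)
    have ofb: "ofilter ?r (segment b)" using segment[of b] by simp
    have "segment b \<noteq> Field ?r" using lt segment_subset_Field[of a] by auto
    then obtain x where x: "x \<in> Field ?r" "segment b = underS ?r x"
      using ofb wo_rel.ofilter_underS_Field[OF wo, of "segment b"] by auto
    obtain y where y: "y \<in> segment a" "y \<notin> underS ?r x" using lt x by auto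
    have "(x, y) \<in> ?r"
      using x y segment_subset_Field[of a] wo_rel.TOTALS[OF wo] wo_rel.REFL[OF wo]
      by (auto simp: underS_def refl_on_def)
    then have "x \<in> segment a"
      using y ofa by (auto simp: Order_Relation.ofilter_def under_def)
    moreover have "b = Abs_omega1_ord (underS ?r x)" using x by (metis segment_inverse)
    ultimately show "b \<in> (\<lambda>x. Abs_omega1_ord (underS ?r x)) ` segment a" by blast
  qed
  ultimately show ?thesis by (simp add: bij_betw_def)
qed

text \<open>The next lemma confirms that the elements below \<^term>\<open>top\<close> are exactly the countable ordinals.\<close>

lemma less_top_iff_countable: "(a::omega1_ord) < top \<longleftrightarrow> countable {..<a}"
proof -
  let ?r = "cardSuc natLeq"
  note wo = wo_rel_cardSuc_natLeq
  have card: "Card_order ?r" by (simp add: cardSuc_Card_order natLeq_Card_order)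
  have "countable {..<a} \<longleftrightarrow> countable (segment a)"
    using countableI_bij1[OF bij_betw_segment[of a]] countableI_bij2[OF bij_betw_segment[of a]]
    by (rule iffI[rotated])
  also have "\<dots> \<longleftrightarrow> segment a \<noteq> Field ?r"
  proof
    assume "countable (segment a)"
    then have "|segment a| <o ?r" by (simp add: countable_iff_ordLess_cardSuc)
    then show "segment a \<noteq> Field ?r"
      using card_of_Field_ordIso[OF card] not_ordLess_ordIso[of "|Field ?r|" ?r] by metis
  next
    assume "segment a \<noteq> Field ?r"
    moreover have "ofilter ?r (segment a)" using segment[of a] by simp
    ultimately obtain x where "x \<in> Field ?r" "segment a = underS ?r x"
      using wo_rel.ofilter_underS_Field[OF wo, of "segment a"] by auto
    then show "countable (segment a)"
      using card_of_underS[OF card] by (simp add: countable_iff_ordLess_cardSuc)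
  qed
  also have "\<dots> \<longleftrightarrow> a < top"
    using segment_subset_Field[of a] by (auto simp: less_omega1_ord.rep_eq top_omega1_ord.rep_eq)
  finally show ?thesis ..
qed

unbundle no cardinal_syntax

text \<open>The successor is meaningful only for countable ordinals, i.e. below \<^term>\<open>top\<close>.\<close>

definition ord_succ :: "omega1_ord \<Rightarrow> omega1_ord" where
  "ord_succ a = (LEAST b. a < b)"

definition ord_omega :: omega1_ord where
  "ord_omega = (LEAST a. infinite {..<a})"

text \<open>A finite ordinal is the number of its predecessors.\<close>

definition enat_of_ord :: "omega1_ord \<Rightarrow> enat" where
  "enat_of_ord a = (if finite {..<a} then enat (card {..<a}) else \<infinity>)"

lemma less_ord_succ: "a < top \<Longrightarrow> a < ord_succ a"
  unfolding ord_succ_def by (rule LeastI)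

lemma ord_succ_le: "a < b \<Longrightarrow> ord_succ a \<le> b"
  unfolding ord_succ_def by (rule Least_le)

lemma ord_succ_inj: "\<lbrakk>a < top; b < top; ord_succ a = ord_succ b\<rbrakk> \<Longrightarrow> a = b"
  by (metis less_ord_succ ord_succ_le leD linorder_neqE)


section \<open>The Szlenk index and the convex Szlenk index\<close>

text \<open>For real-valued functionals the strong operator topology is the topology of pointwise
  convergence on the space, i.e. the weak-star topology of the dual.\<close>

abbreviation weak_star :: "('a::real_normed_vector \<Rightarrow>\<^sub>L real) topology" where
  "weak_star \<equiv> strong_operator_topology"

text \<open>\<^const>\<open>diameter\<close> is a real number and is unspecified on unbounded sets, hence the explicit
  boundedness condition. It holds automatically if \<open>K\<close> is norm-bounded.\<close>

definition szlenk_deriv ::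
  "real \<Rightarrow> ('a::real_normed_vector \<Rightarrow>\<^sub>L real) set \<Rightarrow> ('a \<Rightarrow>\<^sub>L real) set" where
  "szlenk_deriv \<epsilon> K =
     K - \<Union>{V. openin weak_star V \<and> bounded (V \<inter> K) \<and> diameter (V \<inter> K) \<le> \<epsilon>}"

text \<open>Transfinite iteration; the three defining clauses are restated separately below.\<close>

function szlenk_iter ::
  "real \<Rightarrow> ('a::real_normed_vector \<Rightarrow>\<^sub>L real) set \<Rightarrow> omega1_ord \<Rightarrow> ('a \<Rightarrow>\<^sub>L real) set" where
  "szlenk_iter \<epsilon> K a =
     (if a = bot then K
      else if \<exists>b<a. a = ord_succ b
        then szlenk_deriv \<epsilon> (szlenk_iter \<epsilon> K (THE b. b < a \<and> a = ord_succ b))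
      else (\<Inter>b\<in>{..<a}. szlenk_iter \<epsilon> K b))"
  by pat_completeness auto
termination
proof (relation "inv_image {(x, y). x < y} (\<lambda>(\<epsilon>, K, a). a)", goal_cases)
  case 1
  show ?case by (intro wf_inv_image wf)
next
  case (2 \<epsilon> K a)
  then obtain b where b: "b < a" "a = ord_succ b" by blast
  have "(THE b. b < a \<and> a = ord_succ b) = b"
    using b ord_succ_inj by (intro the_equality) (auto intro: less_le_trans top_greatest)
  with b(1) show ?case by simp
next
  case 3
  then show ?case by simp
qed

declare szlenk_iter.simps [simp del]

lemma szlenk_iter_zero: "szlenk_iter \<epsilon> K bot = K"
  by (simp add: szlenk_iter.simps)

lemma szlenk_iter_succ:
  assumes "a < top"
  shows "szlenk_iter \<epsilon> K (ord_succ a) = szlenk_deriv \<epsilon> (szlenk_iter \<epsilon> K a)"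
proof -
  have "b = a" if "b < ord_succ a" "ord_succ a = ord_succ b" for b
    using ord_succ_inj[of a b] assms that less_le_trans[OF that(1) top_greatest] by simp
  then have "(THE b. b < ord_succ a \<and> ord_succ a = ord_succ b) = a"
    using less_ord_succ[OF assms] by (intro the_equality) auto
  moreover have "ord_succ a \<noteq> bot" "\<exists>b<ord_succ a. ord_succ a = ord_succ b"
    using less_ord_succ[OF assms] by auto
  ultimately show ?thesis by (subst szlenk_iter.simps) simp
qed

lemma szlenk_iter_limit:
  assumes "a \<noteq> bot" and "\<not> (\<exists>b<a. a = ord_succ b)"
  shows "szlenk_iter \<epsilon> K a = (\<Inter>b\<in>{..<a}. szlenk_iter \<epsilon> K b)"
  using assms by (subst szlenk_iter.simps) (simp only: if_False)

text \<open>\<open>Sz(X, \<epsilon>)\<close> and \<open>Sz(X)\<close>, with the space \<open>X\<close> given as a type.\<close>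

definition Sz_eps :: "'a::real_normed_vector itself \<Rightarrow> real \<Rightarrow> omega1_ord" where
  "Sz_eps _ \<epsilon> =
     (if \<exists>a<top. szlenk_iter \<epsilon> (cball (0 :: 'a \<Rightarrow>\<^sub>L real) 1) a = {}
      then LEAST a. szlenk_iter \<epsilon> (cball (0 :: 'a \<Rightarrow>\<^sub>L real) 1) a = {}
      else top)"

definition Sz :: "'a::real_normed_vector itself \<Rightarrow> omega1_ord" where
  "Sz X = (SUP \<epsilon>\<in>{0<..}. Sz_eps X \<epsilon>)"

definition convex_szlenk_deriv ::
  "real \<Rightarrow> ('a::real_normed_vector \<Rightarrow>\<^sub>L real) set \<Rightarrow> ('a \<Rightarrow>\<^sub>L real) set" where
  "convex_szlenk_deriv \<epsilon> K = weak_star closure_of (convex hull (szlenk_deriv \<epsilon> K))"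

text \<open>\<open>Cz(X, \<epsilon>)\<close>; the infimum of the empty set of extended naturals is \<open>\<infinity>\<close>.\<close>

definition Cz_eps :: "'a::real_normed_vector itself \<Rightarrow> real \<Rightarrow> enat" where
  "Cz_eps _ \<epsilon> =
     Inf {enat n | n. (convex_szlenk_deriv \<epsilon> ^^ n) (cball (0 :: 'a \<Rightarrow>\<^sub>L real) 1) = {}}"

end

(* A convex function on the dual ball that drops under the convex derivation is found by duality.
   Write B for the dual ball, let q_k z be the number of Szlenk derivations at scale 2^k e after
   which z has been removed from B, and let g = sum_k 2 (2^k e) q_k. Every x in B has a weak-star
   neighbourhood on which g z + |z - x| - 2 e <= g x. By weak-star compactness of B, the convex
   function F x = sup_{z in B} (z x + g z) on X then satisfies F (x + y) <= F x + 2 e + o(1) whenever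
   y in the unit ball is almost annihilated by a suitable finite set of functionals. Consequently the
   conjugate of F, which is convex and weak-star lower semicontinuous, decreases by 2 e at each
   convex derivation at scale 16 e. Since 0 <= F 0 - (2 e) n must hold at every point that survives n
   of these and F 0 <= sum_k 2 (2^k e) Sz(X, 2^k e), this yields
   Cz(X, 16 e) <= 1 + sum_k 2^k Sz(X, 2^k e), a geometric series of ratio 2^(1-p) when p > 1. *)

theory Submission
  imports Defs
begin

section \<open>Weak-star closed sets and weak-star compactness of the dual ball\<close>

lemma openin_weak_star_preimage:
  assumes "open U"
  shows "openin weak_star {z :: 'a::real_normed_vector \<Rightarrow>\<^sub>L real. blinfun_apply z x \<in> U}"
proof -
  have continuous_map_evaluation:
    "continuous_map weak_star euclidean (\<lambda>z :: 'a \<Rightarrow>\<^sub>L real. blinfun_apply z x)"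
    by (rule strong_operator_topology_continuous_evaluation)
  have "openin weak_star ((\<lambda>z. blinfun_apply z x) -` U \<inter> topspace weak_star)"
    using assms continuous_map_evaluation by (simp add: continuous_map_alt)
  then show ?thesis
    by (simp add: vimage_def strong_operator_topology_topspace)
qed

lemma closedin_weak_star_le:
  "closedin weak_star {z :: 'a::real_normed_vector \<Rightarrow>\<^sub>L real. blinfun_apply z x \<le> c}"
proof -
  have "UNIV - {z :: 'a \<Rightarrow>\<^sub>L real. blinfun_apply z x \<le> c} = {z. blinfun_apply z x \<in> {c<..}}"
    by auto
  then show ?thesis
    using openin_weak_star_preimage[of "{c<..}" x]
    by (simp add: closedin_def strong_operator_topology_topspace)
qed

lemma cball_dual_iff:
  "(z :: 'a::real_normed_vector \<Rightarrow>\<^sub>L real) \<in> cball 0 1 \<longleftrightarrow> (\<forall>x. blinfun_apply z x \<le> norm x)"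
proof
  assume "z \<in> cball 0 1"
  then show "\<forall>x. blinfun_apply z x \<le> norm x"
    using norm_blinfun[of z] mult_right_mono[of "norm z" 1]
    by (smt (verit) dist_0_norm mem_cball mult_cancel_right1 norm_ge_zero real_norm_def)
next
  assume *: "\<forall>x. blinfun_apply z x \<le> norm x"
  have "norm (blinfun_apply z x) \<le> 1 * norm x" for x
    using *[rule_format, of x] *[rule_format, of "- x"] by (simp add: blinfun.minus_right abs_le_iff)
  then show "z \<in> cball 0 1" by (simp add: norm_blinfun_bound)
qed

lemma closedin_weak_star_dual_cball:
  "closedin weak_star (cball (0 :: 'a::real_normed_vector \<Rightarrow>\<^sub>L real) 1)"
proof -
  have "cball (0 :: 'a \<Rightarrow>\<^sub>L real) 1 = (\<Inter>x. {z. blinfun_apply z x \<le> norm x})"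
    using cball_dual_iff by blast
  then show ?thesis by (auto intro!: closedin_Inter closedin_weak_star_le)
qed

text \<open>By Tychonoff the product of the intervals \<open>[- norm x, norm x]\<close> is compact,
  and the dual ball embeds in it as the closed subset of additive, homogeneous functions.\<close>

theorem banach_alaoglu:
  "compactin weak_star (cball (0 :: 'a::real_normed_vector \<Rightarrow>\<^sub>L real) 1)"
proof -
  let ?B = "cball (0 :: 'a \<Rightarrow>\<^sub>L real) 1"
  let ?P = "PiE UNIV (\<lambda>x::'a. cball (0::real) (norm x))"
  let ?L = "{f :: 'a \<Rightarrow> real. \<forall>x y. f (x + y) = f x + f y} \<inter> {f. \<forall>c x. f (c *\<^sub>R x) = c * f x}"
  have "compact ?P"
    using compactin_PiE[of "\<lambda>_::'a. euclideanreal" UNIV "\<lambda>x. cball 0 (norm x)"]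
    by (simp add: euclidean_product_topology)
  moreover have "closed ?L"
    by (intro closed_Int closed_Collect_all closed_Collect_eq continuous_intros
        continuous_on_product_coordinates)
  ultimately have "compact (?P \<inter> ?L)" by (rule compact_Int_closed)
  moreover have "blinfun_apply ` ?B = ?P \<inter> ?L"
  proof (intro equalityI subsetI)
    fix f assume "f \<in> blinfun_apply ` ?B"
    then obtain z where z: "z \<in> ?B" "f = blinfun_apply z" by blast
    have "\<bar>f x\<bar> \<le> norm x" for x
      using z(1)[unfolded cball_dual_iff, rule_format, of x]
        z(1)[unfolded cball_dual_iff, rule_format, of "- x"] z(2)
      by (simp add: blinfun.minus_right abs_le_iff)
    then show "f \<in> ?P \<inter> ?L"
      by (auto simp: z(2) blinfun.add_right blinfun.scaleR_right)
  next
    fix f assume f: "f \<in> ?P \<inter> ?L"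
    then have b: "\<bar>f x\<bar> \<le> norm x" for x by (auto simp: PiE_iff)
    have "bounded_linear f"
      using f b by (intro bounded_linear_intro[of _ 1]) auto
    then have "f = blinfun_apply (Blinfun f)" by (simp add: bounded_linear_Blinfun_apply)
    moreover from this have "Blinfun f \<in> ?B"
      using b by (metis cball_dual_iff abs_le_D1)
    ultimately show "f \<in> blinfun_apply ` ?B" by blast
  qed
  ultimately have comp: "compact (blinfun_apply ` ?B)" by simp
  show ?thesis
    unfolding compactin_def
  proof (intro conjI allI impI)
    show "?B \<subseteq> topspace weak_star" by (simp add: strong_operator_topology_topspace)
    fix \<U> :: "('a \<Rightarrow>\<^sub>L real) set set"
    assume \<U>: "Ball \<U> (openin weak_star) \<and> ?B \<subseteq> \<Union>\<U>"
    \<comment> \<open>The weak-star topology is the pullback of the product topology along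
      \<open>blinfun_apply\<close>, so a cover of the ball comes from an open cover of its compact
      image.\<close>
    then have "\<forall>U\<in>\<U>. \<exists>V. open V \<and> U = blinfun_apply -` V"
      by (simp add: strong_operator_topology_def openin_pullback_topology)
    then obtain W where W: "\<And>U. U \<in> \<U> \<Longrightarrow> open (W U) \<and> U = blinfun_apply -` W U"
      by metis
    have "blinfun_apply ` ?B \<subseteq> \<Union> (W ` \<U>)" using \<U> W by blast
    from compactE[OF comp this]
    obtain \<C> where "\<C> \<subseteq> W ` \<U>" "finite \<C>" "blinfun_apply ` ?B \<subseteq> \<Union>\<C>"
      using W by (metis imageE)
    then obtain \<F> where "\<F> \<subseteq> \<U>" "finite \<F>" "blinfun_apply ` ?B \<subseteq> \<Union>(W ` \<F>)"
      by (metis finite_subset_image)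
    moreover from this have "?B \<subseteq> \<Union>\<F>" using W by blast
    ultimately show "\<exists>\<F>. finite \<F> \<and> \<F> \<subseteq> \<U> \<and> ?B \<subseteq> \<Union>\<F>" by blast
  qed
qed

section \<open>Almost norming vectors that almost annihilate a finite set\<close>

lemma norm_almost_attained:
  fixes w :: "'a::real_normed_vector \<Rightarrow>\<^sub>L real"
  assumes "0 < \<eta>"
  obtains y where "norm y \<le> 1" "norm w - \<eta> < blinfun_apply w y"
proof -
  have "\<exists>y. norm y \<le> 1 \<and> norm w - \<eta> < blinfun_apply w y"
  proof (rule ccontr)
    assume "\<not> ?thesis"
    then have *: "blinfun_apply w y \<le> norm w - \<eta>" if "norm y \<le> 1" for y
      using that by force
    have b: "0 \<le> norm w - \<eta>" using *[of 0] by (simp add: blinfun.zero_right)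
    have le: "blinfun_apply w x \<le> (norm w - \<eta>) * norm x" for x
    proof (cases "x = 0")
      case False
      then have "blinfun_apply w (x /\<^sub>R norm x) \<le> norm w - \<eta>" by (intro *) simp
      then show ?thesis using False by (simp add: blinfun.scaleR_right field_simps)
    qed (simp add: blinfun.zero_right)
    have "norm (blinfun_apply w x) \<le> (norm w - \<eta>) * norm x" for x
      using le[of x] le[of "- x"] by (simp add: blinfun.minus_right abs_le_iff)
    then have "norm w \<le> norm w - \<eta>" by (rule norm_blinfun_bound[OF b])
    then show False using assms by simp
  qed
  then show ?thesis using that by blast
qed

text \<open>The values on \<open>A\<close> map the unit ball to a bounded set in a
  finite-dimensional space. A grid of mesh \<open>\<delta>\<close>, encoded by floors, has finitely
  many occupied cells there; \<open>Y\<close> takes one preimage from each.\<close>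

lemma finite_net_on_functionals:
  fixes A :: "('a::real_normed_vector \<Rightarrow>\<^sub>L real) set"
  assumes "finite A" "0 < \<delta>"
  obtains Y where "finite Y" "Y \<subseteq> cball 0 1"
    "\<And>y. norm y \<le> 1 \<Longrightarrow> \<exists>u\<in>Y. \<forall>a\<in>A. \<bar>blinfun_apply a y - blinfun_apply a u\<bar> < \<delta>"
proof -
  let ?B = "cball (0::'a) 1"
  define p where "p y = (\<lambda>a\<in>A. \<lfloor>blinfun_apply a y / \<delta>\<rfloor>)" for y
  define R where "R a = {\<lfloor>- norm a / \<delta>\<rfloor>..\<lfloor>norm a / \<delta>\<rfloor>}" for a :: "'a \<Rightarrow>\<^sub>L real"
  have "p ` ?B \<subseteq> PiE A R"
  proof (intro image_subsetI)
    fix y assume "y \<in> ?B"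
    then have "norm (blinfun_apply a y) \<le> norm a" for a :: "'a \<Rightarrow>\<^sub>L real"
      using norm_blinfun[of a y] mult_left_mono[of "norm y" 1 "norm a"] by simp
    then have "- norm a / \<delta> \<le> blinfun_apply a y / \<delta>" "blinfun_apply a y / \<delta> \<le> norm a / \<delta>"
      for a :: "'a \<Rightarrow>\<^sub>L real"
      using assms(2) by (simp_all add: divide_le_cancel abs_le_iff minus_le_iff
          del: divide_minus_left)
    then show "p y \<in> PiE A R"
      by (auto simp: p_def R_def intro!: floor_mono)
  qed
  moreover have "finite (PiE A R)" using assms(1) by (auto intro!: finite_PiE simp: R_def)
  ultimately have fin: "finite (p ` ?B)" by (rule finite_subset)
  show ?thesis
  proof (rule that)
    show "finite (inv_into ?B p ` p ` ?B)" using fin by simp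
    show "inv_into ?B p ` p ` ?B \<subseteq> ?B" by (auto intro!: inv_into_into simp del: mem_cball)
    fix y :: 'a assume "norm y \<le> 1"
    then have y: "p y \<in> p ` ?B" by simp
    define u where "u = inv_into ?B p (p y)"
    have "p u = p y" unfolding u_def by (rule f_inv_into_f[OF y])
    have "\<bar>blinfun_apply a y - blinfun_apply a u\<bar> < \<delta>" if "a \<in> A" for a
    proof -
      have "\<lfloor>blinfun_apply a u / \<delta>\<rfloor> = \<lfloor>blinfun_apply a y / \<delta>\<rfloor>"
        using fun_cong[OF \<open>p u = p y\<close>, of a] that by (simp add: p_def)
      then have "\<bar>blinfun_apply a y / \<delta> - blinfun_apply a u / \<delta>\<bar> < 1" by linarith
      then show ?thesis using assms(2)
        by (simp add: diff_divide_distrib[symmetric] abs_divide)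
    qed
    then show "\<exists>u\<in>inv_into ?B p ` p ` ?B. \<forall>a\<in>A. \<bar>blinfun_apply a y - blinfun_apply a u\<bar> < \<delta>"
      using y u_def by blast
  qed
qed

text \<open>Take an almost norming \<open>y\<close> for \<open>w\<close> and subtract a net point
  \<open>u\<close> with nearly the same values on \<open>A\<close>. Since \<open>w\<close> is small
  at \<open>u\<close>, little is lost; halving \<open>y - u\<close> to return to the unit ball costs
  the factor 1/2. The set \<open>Y\<close> is chosen before \<open>w\<close>, so smallness on
  \<open>Y\<close> can later serve as a weak-star neighbourhood.\<close>

lemma large_on_almost_annihilator:
  fixes A :: "('a::real_normed_vector \<Rightarrow>\<^sub>L real) set"
  assumes "finite A" "0 < \<delta>" "0 < \<eta>"
  obtains Y where "finite Y"
    "\<And>w. (\<And>u. u \<in> Y \<Longrightarrow> \<bar>blinfun_apply w u\<bar> < \<eta>) \<Longrightarrow>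
       \<exists>y. norm y \<le> 1 \<and> (\<forall>a\<in>A. \<bar>blinfun_apply a y\<bar> < \<delta>) \<and> norm w / 2 - \<eta> \<le> blinfun_apply w y"
proof -
  obtain Y where Y: "finite Y" "Y \<subseteq> cball 0 1"
    "\<And>y. norm y \<le> 1 \<Longrightarrow> \<exists>u\<in>Y. \<forall>a\<in>A. \<bar>blinfun_apply a y - blinfun_apply a u\<bar> < \<delta>"
    using finite_net_on_functionals[OF assms(1,2)] by blast
  show ?thesis
  proof (rule that[OF Y(1)])
    fix w :: "'a \<Rightarrow>\<^sub>L real" assume w: "\<And>u. u \<in> Y \<Longrightarrow> \<bar>blinfun_apply w u\<bar> < \<eta>"
    obtain y where y: "norm y \<le> 1" "norm w - \<eta> < blinfun_apply w y"
      using norm_almost_attained[OF assms(3)] by blast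
    obtain u where u: "u \<in> Y" "\<And>a. a \<in> A \<Longrightarrow> \<bar>blinfun_apply a y - blinfun_apply a u\<bar> < \<delta>"
      using Y(3)[OF y(1)] by blast
    let ?v = "(1/2) *\<^sub>R (y - u)"
    have "norm ?v \<le> 1" using norm_triangle_ineq4[of y u] y(1) u(1) Y(2) by auto
    moreover have "\<bar>blinfun_apply a ?v\<bar> < \<delta>" if "a \<in> A" for a
      using u(2)[OF that] by (simp add: blinfun.scaleR_right blinfun.diff_right)
    moreover have "norm w / 2 - \<eta> \<le> blinfun_apply w ?v"
      using w[OF u(1)] y(2) by (simp add: blinfun.scaleR_right blinfun.diff_right)
    ultimately show "\<exists>y. norm y \<le> 1 \<and> (\<forall>a\<in>A. \<bar>blinfun_apply a y\<bar> < \<delta>)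
        \<and> norm w / 2 - \<eta> \<le> blinfun_apply w y" by blast
  qed
qed

section \<open>The convex function on the space and its drop under derivation\<close>

text \<open>This is the Fenchel conjugate of the function equal to \<open>- g\<close> on the dual
  ball and infinite elsewhere; for \<open>g = 0\<close> it is the norm.\<close>

definition perturbed_norm ::
  "(('a::real_normed_vector \<Rightarrow>\<^sub>L real) \<Rightarrow> real) \<Rightarrow> 'a \<Rightarrow> real" where
  "perturbed_norm g x = (SUP z\<in>cball 0 1. blinfun_apply z x + g z)"

lemma perturbed_norm_upper:
  fixes z :: "'a::real_normed_vector \<Rightarrow>\<^sub>L real"
  assumes "\<And>z :: 'a \<Rightarrow>\<^sub>L real. g z \<le> M" and "z \<in> cball 0 1"
  shows "blinfun_apply z x + g z \<le> perturbed_norm g x"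
  unfolding perturbed_norm_def
proof (rule cSUP_upper[OF assms(2)])
  show "bdd_above ((\<lambda>z. blinfun_apply z x + g z) ` cball 0 1)"
    using assms(1) cball_dual_iff by (intro bdd_aboveI2[of _ _ "norm x + M"] add_mono) blast+
qed

text \<open>Compactness leaves finitely many centres \<open>a\<close>. Replacing \<open>z\<close> by
  a nearby centre gains \<open>norm (z - a) - e\<close> in \<open>g\<close>, which pays for the
  change of at most \<open>norm (z - a)\<close> in the value at \<open>y\<close>; the value of the
  centre itself at \<open>y\<close> is below \<open>\<eta>\<close>.\<close>

lemma perturbed_norm_almost_subadditive:
  fixes g :: "('a::real_normed_vector \<Rightarrow>\<^sub>L real) \<Rightarrow> real"
  assumes g_le: "\<And>z. g z \<le> M"
    and steep: "\<And>x. x \<in> cball 0 1 \<Longrightarrow> \<exists>V. openin weak_star V \<and> x \<in> V \<and>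
      (\<forall>z\<in>V \<inter> cball 0 1. g z + (norm (z - x) - e) \<le> g x)"
    and "0 < \<eta>"
  obtains A where "finite A"
    "\<And>y. \<lbrakk>norm y \<le> 1; \<And>a. a \<in> A \<Longrightarrow> \<bar>blinfun_apply a y\<bar> < \<eta>\<rbrakk>
      \<Longrightarrow> perturbed_norm g (x + y) \<le> perturbed_norm g x + e + 2 * \<eta>"
proof -
  let ?B = "cball (0 :: 'a \<Rightarrow>\<^sub>L real) 1"
  have "\<forall>a\<in>?B. \<exists>V. openin weak_star V \<and> a \<in> V \<and>
      (\<forall>z\<in>V \<inter> ?B. g z + (norm (z - a) - e) \<le> g a)"
    by (intro ballI steep)
  from bchoice[OF this] obtain V where "\<forall>a\<in>?B. openin weak_star (V a) \<and> a \<in> V a \<and>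
      (\<forall>z\<in>V a \<inter> ?B. g z + (norm (z - a) - e) \<le> g a)" ..
  then have V: "\<And>a. a \<in> ?B \<Longrightarrow> openin weak_star (V a)" "\<And>a. a \<in> ?B \<Longrightarrow> a \<in> V a"
    "\<And>a z. \<lbrakk>a \<in> ?B; z \<in> V a; z \<in> ?B\<rbrakk> \<Longrightarrow> g z + (norm (z - a) - e) \<le> g a"
    by (blast, blast, blast)
  \<comment> \<open>The extra condition keeps the value at \<open>x\<close> within
    \<open>\<eta>\<close>, so the resulting finite set depends on \<open>x\<close>.\<close>
  define W where "W a = V a \<inter> {z. blinfun_apply z x \<in> ball (blinfun_apply a x) \<eta>}" for a
  have "\<And>U. U \<in> W ` ?B \<Longrightarrow> openin weak_star U"
    using V(1) by (auto simp: W_def simp del: mem_ball mem_cball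
        intro!: openin_Int openin_weak_star_preimage)
  moreover have "?B \<subseteq> \<Union> (W ` ?B)" using V(2) \<open>0 < \<eta>\<close> by (fastforce simp: W_def)
  ultimately obtain \<F> where "finite \<F>" "\<F> \<subseteq> W ` ?B" "?B \<subseteq> \<Union>\<F>"
    using compactinD[OF banach_alaoglu] by metis
  then obtain A where A: "A \<subseteq> ?B" "finite A" "?B \<subseteq> \<Union> (W ` A)"
    by (metis finite_subset_image)
  show ?thesis
  proof (rule that[OF A(2)])
    fix y assume y: "norm y \<le> 1" "\<And>a. a \<in> A \<Longrightarrow> \<bar>blinfun_apply a y\<bar> < \<eta>"
    show "perturbed_norm g (x + y) \<le> perturbed_norm g x + e + 2 * \<eta>"
      unfolding perturbed_norm_def[of g "x + y"]
    proof (rule cSUP_least)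
      fix z assume z: "z \<in> ?B"
      then obtain a where a: "a \<in> A" "z \<in> W a" using A(3) by blast
      have "\<bar>blinfun_apply a y\<bar> < \<eta>" using y(2) a(1) .
      moreover have "\<bar>blinfun_apply a x - blinfun_apply z x\<bar> < \<eta>"
        using a(2) by (simp add: W_def dist_real_def)
      moreover have "g z + (norm (z - a) - e) \<le> g a"
        using V(3)[of a z] a A(1) z by (auto simp: W_def)
      moreover have "blinfun_apply a x + g a \<le> perturbed_norm g x"
        using perturbed_norm_upper[where g=g and M=M, OF g_le] a(1) A(1) by blast
      moreover have "blinfun_apply (z - a) y \<le> norm (z - a)"
        using norm_blinfun[of "z - a" y] mult_left_mono[OF y(1), of "norm (z - a)"] by simp
      ultimately show "blinfun_apply z (x + y) + g z \<le> perturbed_norm g x + e + 2 * \<eta>"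
        by (simp add: blinfun.diff_left blinfun.add_right)
    qed simp
  qed
qed

text \<open>Near a surviving \<open>w\<close> there is some \<open>z\<close> in \<open>K\<close>
  with \<open>norm (z - w) > \<delta> / 2\<close>. Moving \<open>x\<close> by a vector
  \<open>y\<close> on which \<open>z - w\<close> is about \<open>\<delta> / 4\<close>, while
  \<open>w\<close> and \<open>A\<close> are almost zero, yields
  \<open>w x + \<delta> / 4 \<le> z (x + y)\<close> up to small errors, and the right side is
  bounded by the previous lemma.\<close>

lemma szlenk_deriv_drop:
  fixes g :: "('a::real_normed_vector \<Rightarrow>\<^sub>L real) \<Rightarrow> real" and K
  assumes g_le: "\<And>z. g z \<le> M"
    and steep: "\<And>x. x \<in> cball 0 1 \<Longrightarrow> \<exists>V. openin weak_star V \<and> x \<in> V \<and>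
      (\<forall>z\<in>V \<inter> cball 0 1. g z + (norm (z - x) - e) \<le> g x)"
    and K: "bounded K" "\<And>z x. z \<in> K \<Longrightarrow> blinfun_apply z x \<le> perturbed_norm g x + t"
    and w: "w \<in> szlenk_deriv \<delta> K" and "0 < \<delta>"
  shows "blinfun_apply w x \<le> perturbed_norm g x + (t + e - \<delta> / 4)"
proof (rule field_le_epsilon)
  fix \<gamma> :: real assume "0 < \<gamma>"
  \<comment> \<open>Five errors of size \<open>\<eta>\<close> occur: two from almost subadditivity,
    and one each from \<open>(z - w) x\<close>, from \<open>w y\<close> and from the lower bound on
    \<open>(z - w) y\<close>.\<close>
  define \<eta> where "\<eta> = \<gamma> / 5"
  have "0 < \<eta>" "\<gamma> = 5 * \<eta>" using \<open>0 < \<gamma>\<close> by (simp_all add: \<eta>_def)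
  obtain A where A: "finite A"
    "\<And>y. \<lbrakk>norm y \<le> 1; \<And>a. a \<in> A \<Longrightarrow> \<bar>blinfun_apply a y\<bar> < \<eta>\<rbrakk>
      \<Longrightarrow> perturbed_norm g (x + y) \<le> perturbed_norm g x + e + 2 * \<eta>"
    using perturbed_norm_almost_subadditive[where g=g and M=M and e=e, OF g_le steep \<open>0 < \<eta>\<close>, of x]
    by blast
  obtain Y where Y: "finite Y"
    "\<And>u. (\<And>v. v \<in> Y \<Longrightarrow> \<bar>blinfun_apply u v\<bar> < \<eta>) \<Longrightarrow>
      \<exists>y. norm y \<le> 1 \<and> (\<forall>a\<in>insert w A. \<bar>blinfun_apply a y\<bar> < \<eta>) \<and> norm u / 2 - \<eta> \<le> blinfun_apply u y"
    using large_on_almost_annihilator[of "insert w A" \<eta> \<eta>] A(1) \<open>0 < \<eta>\<close>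
    by (metis finite_insert)
  define V where "V = {z. \<forall>v\<in>insert x Y. blinfun_apply z v \<in> ball (blinfun_apply w v) \<eta>}"
  have V: "openin weak_star V" "w \<in> V"
    unfolding V_def
    using strong_operator_topology_basis[of "insert x Y" "\<lambda>v. ball (blinfun_apply w v) \<eta>" "\<lambda>v. v"]
      Y(1) \<open>0 < \<eta>\<close> by (simp_all del: mem_ball add: centre_in_ball)
  have bV: "bounded (V \<inter> K)" using K(1) by (meson bounded_Int)
  have "w \<in> K" using w by (simp add: szlenk_deriv_def)
  have "\<delta> < diameter (V \<inter> K)"
    using w V bV by (force simp: szlenk_deriv_def)
  then obtain a b where "a \<in> V \<inter> K" "b \<in> V \<inter> K" "\<delta> < dist a b"
    using diameter_lower_bounded[OF bV] \<open>0 < \<delta>\<close> by blast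
  \<comment> \<open>By the triangle inequality one of \<open>a\<close>, \<open>b\<close> lies
    farther than \<open>\<delta> / 2\<close> from \<open>w\<close>.\<close>
  then obtain z where z: "z \<in> V" "z \<in> K" "\<delta> / 2 < dist z w"
    using dist_triangle2[of a b w] that by (cases "\<delta> / 2 < dist a w") auto
  have "\<bar>blinfun_apply (z - w) v\<bar> < \<eta>" if "v \<in> insert x Y" for v
    using z(1) that by (auto simp: V_def dist_real_def blinfun.diff_left abs_minus_commute)
  then obtain y where y: "norm y \<le> 1" "\<And>a. a \<in> insert w A \<Longrightarrow> \<bar>blinfun_apply a y\<bar> < \<eta>"
    "norm (z - w) / 2 - \<eta> \<le> blinfun_apply (z - w) y" and x: "\<bar>blinfun_apply (z - w) x\<bar> < \<eta>"
    using Y(2)[of "z - w"] by blast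
  have "blinfun_apply z (x + y) \<le> perturbed_norm g x + e + 2 * \<eta> + t"
    using K(2)[OF z(2), of "x + y"] A(2)[OF y(1)] y(2) by force
  moreover have "\<bar>blinfun_apply w y\<bar> < \<eta>" using y(2) by simp
  ultimately show "blinfun_apply w x \<le> perturbed_norm g x + (t + e - \<delta> / 4) + \<gamma>"
    using x y(3) z(3) \<open>\<gamma> = 5 * \<eta>\<close>
    unfolding blinfun.diff_left blinfun.add_right dist_norm by linarith
qed

section \<open>Szlenk ranks of points and their dyadic combination\<close>

text \<open>Points outside the ball get rank 0. The value is meaningful only when some iterate omits
  \<open>z\<close>.\<close>

definition szlenk_rank :: "real \<Rightarrow> ('a::real_normed_vector \<Rightarrow>\<^sub>L real) \<Rightarrow> nat" where
  "szlenk_rank \<epsilon> z = (LEAST m. z \<notin> (szlenk_deriv \<epsilon> ^^ m) (cball 0 1))"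

lemma szlenk_rank_le: "z \<notin> (szlenk_deriv \<epsilon> ^^ m) (cball 0 1) \<Longrightarrow> szlenk_rank \<epsilon> z \<le> m"
  unfolding szlenk_rank_def by (rule Least_le)

text \<open>Let \<open>r + 1\<close> be the rank of \<open>x\<close>. The open set that removes
  \<open>x\<close> from the iterate \<open>D r\<close> removes all its other points there too, so
  ranks do not exceed that of \<open>x\<close>. Its part in \<open>D r\<close> has diameter at most
  \<open>\<epsilon>\<close>, so a point farther from \<open>x\<close> had already left
  \<open>D r\<close>.\<close>

lemma szlenk_rank_nbhd:
  fixes x :: "'a::real_normed_vector \<Rightarrow>\<^sub>L real"
  assumes "(szlenk_deriv \<epsilon> ^^ N) (cball (0 :: 'a \<Rightarrow>\<^sub>L real) 1) = {}" and x: "x \<in> cball 0 1"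
  shows "\<exists>V. openin weak_star V \<and> x \<in> V \<and> (\<forall>z\<in>V. szlenk_rank \<epsilon> z \<le> szlenk_rank \<epsilon> x \<and>
    (\<epsilon> < norm (z - x) \<longrightarrow> szlenk_rank \<epsilon> z < szlenk_rank \<epsilon> x))"
proof -
  define D where "D m = (szlenk_deriv \<epsilon> ^^ m) (cball (0 :: 'a \<Rightarrow>\<^sub>L real) 1)" for m
  have rank: "szlenk_rank \<epsilon> z = (LEAST m. z \<notin> D m)" for z
    by (simp add: szlenk_rank_def D_def)
  have out: "x \<notin> D (szlenk_rank \<epsilon> x)"
    unfolding rank using assms(1) LeastI[of "\<lambda>m. x \<notin> D m" N] by (simp add: D_def)
  \<comment> \<open>Rank 0 is impossible, because \<open>D 0\<close> is the ball and contains
    \<open>x\<close>.\<close>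
  then obtain r where r: "szlenk_rank \<epsilon> x = Suc r"
    using x by (cases "szlenk_rank \<epsilon> x") (auto simp: D_def)
  have "x \<in> D r" using not_less_Least[of r "\<lambda>m. x \<notin> D m"] r by (simp add: rank)
  moreover have "x \<notin> szlenk_deriv \<epsilon> (D r)" using out r by (simp add: D_def)
  ultimately obtain V where V: "openin weak_star V" "x \<in> V" "bounded (V \<inter> D r)"
    "diameter (V \<inter> D r) \<le> \<epsilon>" by (auto simp: szlenk_deriv_def)
  show ?thesis
  proof (intro exI conjI ballI impI)
    show "openin weak_star V" "x \<in> V" by (fact V)+
    fix z assume z: "z \<in> V"
    then have "z \<notin> szlenk_deriv \<epsilon> (D r)" using V by (auto simp: szlenk_deriv_def)
    then show "szlenk_rank \<epsilon> z \<le> szlenk_rank \<epsilon> x"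
      unfolding r by (intro szlenk_rank_le) (simp add: D_def)
    assume far: "\<epsilon> < norm (z - x)"
    have "z \<notin> D r"
    proof
      assume "z \<in> D r"
      then have "dist z x \<le> \<epsilon>"
        using diameter_bounded_bound[OF V(3), of z x] z V \<open>x \<in> D r\<close> by auto
      then show False using far by (simp add: dist_norm)
    qed
    then show "szlenk_rank \<epsilon> z < szlenk_rank \<epsilon> x"
      using szlenk_rank_le[of z r \<epsilon>] r by (simp add: D_def)
  qed
qed

text \<open>If every scale counts, the sum is
  \<open>2 * e * (2 ^ Suc L - 1) = 4 * 2 ^ L * e - 2 * e\<close>, which is where the cap on
  \<open>d\<close> comes from. If \<open>d\<close> is under the cap of the preceding
  \<open>L\<close>, the new summand is nonnegative; otherwise \<open>d\<close> exceeds all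
  scales.\<close>

lemma dyadic_sum_ge:
  fixes d e :: real
  assumes "0 < e" "d \<le> 4 * 2 ^ L * e"
  shows "d - 2 * e \<le> (\<Sum>k\<le>L. if 2 ^ k * e < d then 2 * (2 ^ k * e) else 0)"
  using assms(2)
proof (induction L)
  case 0
  have "(\<Sum>k\<le>(0::nat). if 2 ^ k * e < d then 2 * (2 ^ k * e) else 0) = (if e < d then 2 * e else 0)"
    by simp
  then show ?case using 0 assms(1) by (auto split: if_splits)
next
  case (Suc L)
  show ?case
  proof (cases "d \<le> 4 * 2 ^ L * e")
    case True
    then show ?thesis using Suc.IH assms(1) by (auto simp: add_increasing2)
  next
    case False
    have "2 ^ k * e < d" if "k \<le> Suc L" for k
    proof -
      have "2 ^ k * e \<le> 2 ^ Suc L * e"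
        using that assms(1) by (intro mult_right_mono power_increasing) auto
      moreover have "0 < 2 ^ L * e" using assms(1) by simp
      ultimately show ?thesis using False by simp
    qed
    then have "(\<Sum>k\<le>Suc L. if 2 ^ k * e < d then 2 * (2 ^ k * e) else 0)
        = (\<Sum>k\<le>Suc L. 2 * (2 ^ k * e))" by (intro sum.cong) auto
    also have "\<dots> = 2 * e * (\<Sum>k\<le>Suc L. 2 ^ k)"
      by (simp add: sum_distrib_left algebra_simps)
    also have "(\<Sum>k\<le>Suc L. 2 ^ k :: real) = 2 ^ Suc (Suc L) - 1"
      by (induction L) simp_all
    finally show ?thesis using Suc.prems by (simp add: algebra_simps)
  qed
qed

section \<open>Emptiness of the iterated convex derivation\<close>

text \<open>The derivation scale \<open>16 * e\<close> lowers the bound by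
  \<open>16 * e / 4 = 4 * e\<close>, and the error in the steepness of \<open>g\<close> gives back
  \<open>2 * e\<close>, leaving a net drop of \<open>2 * e\<close> per step.\<close>

lemma convex_szlenk_iter_empty:
  fixes N :: "nat \<Rightarrow> nat"
  assumes e: "0 < e" "1 \<le> 2 ^ Suc L * e"
    and N: "\<And>k. k \<le> L \<Longrightarrow>
      (szlenk_deriv (2 ^ k * e) ^^ N k) (cball (0 :: 'a::real_normed_vector \<Rightarrow>\<^sub>L real) 1) = {}"
    and n: "(\<Sum>k\<le>L. 2 ^ k * N k) < n"
  shows "(convex_szlenk_deriv (16 * e) ^^ n) (cball (0 :: 'a \<Rightarrow>\<^sub>L real) 1) = {}"
proof -
  let ?B = "cball (0 :: 'a \<Rightarrow>\<^sub>L real) 1"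
  define g where "g z = (\<Sum>k\<le>L. 2 * (2 ^ k * e) * real (szlenk_rank (2 ^ k * e) z))"
    for z :: "'a \<Rightarrow>\<^sub>L real"
  define M where "M = (\<Sum>k\<le>L. 2 * (2 ^ k * e) * real (N k))"
  have g_le: "g z \<le> M" for z
    unfolding g_def M_def using e(1) N
    by (intro sum_mono mult_left_mono) (auto intro!: szlenk_rank_le)
  have g_ge: "0 \<le> g z" for z unfolding g_def using e(1) by (intro sum_nonneg) simp
  have steep: "\<exists>V. openin weak_star V \<and> x \<in> V \<and>
      (\<forall>z\<in>V \<inter> ?B. g z + (norm (z - x) - 2 * e) \<le> g x)" if x: "x \<in> ?B" for x
  proof -
    have "\<forall>k\<in>{..L}. \<exists>V. openin weak_star V \<and> x \<in> V \<and>
      (\<forall>z\<in>V. szlenk_rank (2 ^ k * e) z \<le> szlenk_rank (2 ^ k * e) x \<and>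
        (2 ^ k * e < norm (z - x) \<longrightarrow> szlenk_rank (2 ^ k * e) z < szlenk_rank (2 ^ k * e) x))"
    proof
      fix k assume "k \<in> {..L}"
      then have "(szlenk_deriv (2 ^ k * e) ^^ N k) ?B = {}" by (simp add: N)
      from szlenk_rank_nbhd[OF this x] show "\<exists>V. openin weak_star V \<and> x \<in> V \<and>
        (\<forall>z\<in>V. szlenk_rank (2 ^ k * e) z \<le> szlenk_rank (2 ^ k * e) x \<and>
        (2 ^ k * e < norm (z - x) \<longrightarrow> szlenk_rank (2 ^ k * e) z < szlenk_rank (2 ^ k * e) x))" .
    qed
    from bchoice[OF this] obtain V where "\<forall>k\<in>{..L}. openin weak_star (V k) \<and> x \<in> V k \<and>
      (\<forall>z\<in>V k. szlenk_rank (2 ^ k * e) z \<le> szlenk_rank (2 ^ k * e) x \<and>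
        (2 ^ k * e < norm (z - x) \<longrightarrow> szlenk_rank (2 ^ k * e) z < szlenk_rank (2 ^ k * e) x))" ..
    then have V: "\<And>k. k \<le> L \<Longrightarrow> openin weak_star (V k)" "\<And>k. k \<le> L \<Longrightarrow> x \<in> V k"
      "\<And>k z. \<lbrakk>k \<le> L; z \<in> V k\<rbrakk> \<Longrightarrow> szlenk_rank (2 ^ k * e) z \<le> szlenk_rank (2 ^ k * e) x"
      "\<And>k z. \<lbrakk>k \<le> L; z \<in> V k; 2 ^ k * e < norm (z - x)\<rbrakk> \<Longrightarrow>
        szlenk_rank (2 ^ k * e) z < szlenk_rank (2 ^ k * e) x"
      by auto
    show ?thesis
    \<comment> \<open>Finitely many scales are involved, so the intersection of their neighbourhoods
      is still open.\<close>
    proof (intro exI conjI ballI)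
      show "openin weak_star (\<Inter>k\<le>L. V k)" using V(1) by (intro openin_INT2) auto
      show "x \<in> (\<Inter>k\<le>L. V k)" using V(2) by simp
      fix z assume z: "z \<in> (\<Inter>k\<le>L. V k) \<inter> ?B"
      show "g z + (norm (z - x) - 2 * e) \<le> g x"
      proof -
        \<comment> \<open>The assumption \<open>1 \<le> 2 ^ Suc L * e\<close> gives
          \<open>2 \<le> 4 * 2 ^ L * e\<close>, so the dyadic sum covers every distance within the
          ball.\<close>
        have "norm (z - x) \<le> 2" using norm_triangle_ineq4[of z x] z x by simp
        then have "norm (z - x) - 2 * e
            \<le> (\<Sum>k\<le>L. if 2 ^ k * e < norm (z - x) then 2 * (2 ^ k * e) else 0)"
          using e by (intro dyadic_sum_ge) auto
        then have "g z + (norm (z - x) - 2 * e)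
            \<le> (\<Sum>k\<le>L. 2 * (2 ^ k * e) * real (szlenk_rank (2 ^ k * e) z)
                + (if 2 ^ k * e < norm (z - x) then 2 * (2 ^ k * e) else 0))"
          by (simp add: g_def sum.distrib)
        also have "\<dots> \<le> g x" unfolding g_def
        proof (rule sum_mono)
          fix k assume k: "k \<in> {..L}"
          let ?b = "if 2 ^ k * e < norm (z - x) then 1 else 0 :: real"
          have "real (szlenk_rank (2 ^ k * e) z) + ?b \<le> real (szlenk_rank (2 ^ k * e) x)"
            using V(3)[of k z] V(4)[of k z] k z by auto
          then have "2 * (2 ^ k * e) * (real (szlenk_rank (2 ^ k * e) z) + ?b)
              \<le> 2 * (2 ^ k * e) * real (szlenk_rank (2 ^ k * e) x)"
            using e(1) by (intro mult_left_mono) auto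
          then show "2 * (2 ^ k * e) * real (szlenk_rank (2 ^ k * e) z)
              + (if 2 ^ k * e < norm (z - x) then 2 * (2 ^ k * e) else 0)
              \<le> 2 * (2 ^ k * e) * real (szlenk_rank (2 ^ k * e) x)"
            by (auto simp: algebra_simps)
        qed
        finally show ?thesis by simp
      qed
    qed
  qed
  have sub: "(convex_szlenk_deriv (16 * e) ^^ n) ?B
      \<subseteq> ?B \<inter> {z. \<forall>x. blinfun_apply z x \<le> perturbed_norm g x + - (real n * (2 * e))}" for n
  proof (induction n)
    case 0
    show ?case
    proof clarsimp
      fix z :: "'a \<Rightarrow>\<^sub>L real" and x assume "norm z \<le> 1"
      then show "blinfun_apply z x \<le> perturbed_norm g x"
        using perturbed_norm_upper[where g=g and M=M, OF g_le, of z x] g_ge[of z] by simp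
    qed
  next
    case (Suc n)
    define K where "K = (convex_szlenk_deriv (16 * e) ^^ n) ?B"
    define S where "S = ?B \<inter>
      {z. \<forall>x. blinfun_apply z x \<le> perturbed_norm g x + - (real (Suc n) * (2 * e))}"
    \<comment> \<open>As an intersection of the ball with weak-star closed half-spaces,
      \<open>S\<close> is convex and weak-star closed, so it absorbs the closed convex hull of the
      derived set.\<close>
    have S_eq: "S = ?B \<inter>
        (\<Inter>x. {z. blinfun_apply z x \<le> perturbed_norm g x + - (real (Suc n) * (2 * e))})"
      by (auto simp: S_def)
    have K: "K \<subseteq> ?B" "\<And>z x. z \<in> K \<Longrightarrow> blinfun_apply z x \<le> perturbed_norm g x + - (real n * (2 * e))"
      using Suc.IH by (auto simp: K_def)
    have "bounded K" using K(1) bounded_cball bounded_subset by blast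
    have "szlenk_deriv (16 * e) K \<subseteq> S"
    proof
      fix w assume w: "w \<in> szlenk_deriv (16 * e) K"
      then have "w \<in> ?B" using K(1) by (auto simp: szlenk_deriv_def)
      moreover have "blinfun_apply w x \<le> perturbed_norm g x + - (real (Suc n) * (2 * e))" for x
        using szlenk_deriv_drop[where g=g and M=M and e="2 * e", OF g_le steep \<open>bounded K\<close> K(2) w, of x] e(1)
        by (simp add: algebra_simps)
      ultimately show "w \<in> S" by (simp add: S_def)
    qed
    moreover have "convex S"
    proof -
      have "convex {z :: 'a \<Rightarrow>\<^sub>L real. blinfun_apply z x \<le> c}" for x c
        by (auto simp: convex_def blinfun.add_left blinfun.scaleR_left intro: convex_bound_le)
      then show ?thesis unfolding S_eq by (intro convex_Int convex_INT convex_cball)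
    qed
    moreover have "closedin weak_star S"
    proof -
      show ?thesis unfolding S_eq
        by (auto intro!: closedin_Int closedin_Inter closedin_weak_star_le closedin_weak_star_dual_cball)
    qed
    ultimately have "convex_szlenk_deriv (16 * e) K \<subseteq> S"
      by (simp add: convex_szlenk_deriv_def closure_of_minimal hull_minimal)
    then show ?case by (simp add: K_def S_def)
  qed
  \<comment> \<open>At \<open>0\<close> every functional vanishes, so a surviving point forces
    \<open>n * (2 * e)\<close> to be at most \<open>perturbed_norm g 0\<close>, hence at most
    \<open>M\<close>.\<close>
  have "perturbed_norm g 0 \<le> M"
    unfolding perturbed_norm_def using g_le by (intro cSUP_least) (auto simp: blinfun.zero_right)
  also have "M = real (\<Sum>k\<le>L. 2 ^ k * N k) * (2 * e)"
    unfolding M_def by (simp add: sum_distrib_left sum_distrib_right algebra_simps)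
  also have "\<dots> < real n * (2 * e)" using e(1) iffD2[OF of_nat_less_iff n]
    by (intro mult_strict_right_mono) auto
  finally have less: "perturbed_norm g 0 < real n * (2 * e)" .
  have False if "z \<in> (convex_szlenk_deriv (16 * e) ^^ n) ?B" for z
  proof -
    have "blinfun_apply z 0 \<le> perturbed_norm g 0 + - (real n * (2 * e))"
      using subsetD[OF sub that] by blast
    then show False using less by (simp add: blinfun.zero_right)
  qed
  then show ?thesis by blast
qed

section \<open>From ordinal indices to finite iteration, and the geometric series\<close>

text \<open>A nonzero ordinal with finitely many predecessors is the successor of the largest one,
  so the limit clause never applies.\<close>

lemma szlenk_iter_finite:
  "finite {..<a} \<Longrightarrow> szlenk_iter \<epsilon> K a = (szlenk_deriv \<epsilon> ^^ card {..<a}) K"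
proof (induction a rule: less_induct)
  case (less a)
  show ?case
  proof (cases "a = bot")
    case True
    then have "{..<a} = {}" using not_less_bot by auto
    then show ?thesis using True by (simp add: szlenk_iter_zero)
  next
    case False
    then have "{..<a} \<noteq> {}" by (auto simp: bot.not_eq_extremum)
    define b where "b = Max {..<a}"
    have b: "b < a" "\<And>c. c < a \<Longrightarrow> c \<le> b"
      using Max_in[OF less.prems \<open>{..<a} \<noteq> {}\<close>] Max_ge[OF less.prems] by (auto simp: b_def)
    have btop: "b < top" using b(1) top_greatest by (rule less_le_trans)
    have "a = ord_succ b"
      using ord_succ_le[OF b(1)] b(2)[of "ord_succ b"] less_ord_succ[OF btop]
      by (metis leD order_le_imp_less_or_eq)
    moreover have seg: "{..<a} = insert b {..<b}" using b by force
    moreover have "finite {..<b}" using less.prems seg by simp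
    ultimately show ?thesis
      using less.IH[OF b(1)] szlenk_iter_succ[OF btop, of \<epsilon> K] by simp
  qed
qed

lemma infinite_below_top: "infinite {..<top :: omega1_ord}"
  using less_top_iff_countable[of top] countable_finite by auto

text \<open>Finitely many predecessors exclude the default value \<open>top\<close>, so the index is
  an attained minimum.\<close>

lemma szlenk_iter_Sz_eps_empty:
  assumes "finite {..<Sz_eps TYPE('a::real_normed_vector) \<epsilon>}"
  shows "(szlenk_deriv \<epsilon> ^^ card {..<Sz_eps TYPE('a) \<epsilon>}) (cball (0 :: 'a \<Rightarrow>\<^sub>L real) 1) = {}"
proof -
  have "Sz_eps TYPE('a) \<epsilon> \<noteq> top" using assms infinite_below_top by metis
  then have "szlenk_iter \<epsilon> (cball (0 :: 'a \<Rightarrow>\<^sub>L real) 1) (Sz_eps TYPE('a) \<epsilon>) = {}"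
    unfolding Sz_eps_def by (metis (mono_tags, lifting) LeastI)
  then show ?thesis using szlenk_iter_finite[OF assms] by metis
qed

text \<open>With \<open>q = 2 powr (1 - p)\<close>, the hypothesis at scale \<open>2 ^ k * e\<close>
  bounds the k-th term, weighted by \<open>e powr p\<close>, by \<open>C * q ^ k\<close>. These
  terms are summable since \<open>p > 1\<close>.\<close>

lemma Cz_eps_le:
  fixes p C \<epsilon> :: real
  defines "X \<equiv> TYPE('a::real_normed_vector)"
  assumes p: "1 < p" and \<epsilon>: "0 < \<epsilon>" "\<epsilon> < 1"
    and fin: "\<And>\<delta>. \<lbrakk>0 < \<delta>; \<delta> < 1\<rbrakk> \<Longrightarrow> finite {..<Sz_eps X \<delta>}"
    and le: "\<And>\<delta>. \<lbrakk>0 < \<delta>; \<delta> < 1\<rbrakk> \<Longrightarrow> \<delta> powr p * real (card {..<Sz_eps X \<delta>}) \<le> C"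
  obtains n where "Cz_eps X \<epsilon> \<le> enat n"
    "\<epsilon> powr p * real n \<le> 1 + 16 powr p * C / (1 - 2 powr (1 - p))"
proof -
  define e where "e = \<epsilon> / 16"
  have e: "0 < e" "e < 1" using \<epsilon> by (auto simp: e_def)
  define N where "N k = card {..<Sz_eps X (2 ^ k * e)}" for k :: nat
  define q :: real where "q = 2 powr (1 - p)"
  have q: "0 < q" "q < 1" using p by (auto simp: q_def powr_less_one)
  have "0 \<le> C" using le[of "1/2"] by (rule order_trans[rotated]) auto
  \<comment> \<open>The least such \<open>L\<close> reaches the diameter of the ball while keeping
    all scales up to \<open>L\<close> below 1, where the hypotheses apply.\<close>
  obtain L where L: "1 \<le> 2 ^ Suc L * e" "\<And>k. k < L \<Longrightarrow> 2 ^ Suc k * e < 1"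
  proof -
    obtain j where "1 / e < 2 ^ j" using real_arch_pow[of 2 "1 / e"] by auto
    then have "1 \<le> 2 ^ Suc j * e" using e by (simp add: field_simps)
    then show ?thesis
      using that[of "LEAST j. 1 \<le> 2 ^ Suc j * e"] LeastI[of "\<lambda>j. 1 \<le> 2 ^ Suc j * e" j]
        not_less_Least[of _ "\<lambda>j. 1 \<le> 2 ^ Suc j * e"] by (simp add: not_le)
  qed
  have small: "0 < 2 ^ k * e" "2 ^ k * e < 1" if "k \<le> L" for k
    using e that L(2)[of "k - 1"] by (cases k; simp)+
  \<comment> \<open>The successor gives the strict inequality required for emptiness; it contributes
    the summand 1 of the final bound, because \<open>\<epsilon> powr p \<le> 1\<close>.\<close>
  define n where "n = Suc (\<Sum>k\<le>L. 2 ^ k * N k)"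
  have "(convex_szlenk_deriv (16 * e) ^^ n) (cball (0 :: 'a \<Rightarrow>\<^sub>L real) 1) = {}"
  proof (rule convex_szlenk_iter_empty[OF e(1) L(1)])
    show "(szlenk_deriv (2 ^ k * e) ^^ N k) (cball (0 :: 'a \<Rightarrow>\<^sub>L real) 1) = {}" if "k \<le> L" for k
      unfolding N_def X_def
      using fin[OF small[OF that]] by (intro szlenk_iter_Sz_eps_empty) (simp add: X_def)
  qed (simp add: n_def)
  then have "Cz_eps X \<epsilon> \<le> enat n"
    unfolding Cz_eps_def by (intro Inf_lower) (auto simp: e_def)
  moreover have "\<epsilon> powr p * real n \<le> 1 + 16 powr p * C / (1 - q)"
  proof -
    have bound: "e powr p * (2 ^ k * real (N k)) \<le> C * q ^ k" if "k \<le> L" for k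
    proof -
      have "q * 2 powr p = 2" by (simp add: q_def flip: powr_add)
      moreover have "(2 ^ k * e) powr p = (2 powr p) ^ k * e powr p"
        using e by (simp add: powr_mult powr_powr_swap powr_power mult.commute flip: powr_realpow)
      ultimately have "q ^ k * (2 ^ k * e) powr p = 2 ^ k * e powr p"
        by (simp flip: power_mult_distrib mult.assoc)
      then have "e powr p * (2 ^ k * real (N k)) = q ^ k * ((2 ^ k * e) powr p * real (N k))"
        by (simp add: algebra_simps)
      also have "\<dots> \<le> q ^ k * C"
        using le[OF small[OF that]] q by (intro mult_left_mono) (auto simp: N_def)
      finally show ?thesis by (simp add: mult.commute)
    qed
    have "e powr p * (\<Sum>k\<le>L. 2 ^ k * real (N k)) \<le> (\<Sum>k\<le>L. C * q ^ k)"
      unfolding sum_distrib_left using bound by (intro sum_mono) simp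
    also have "\<dots> = C * (\<Sum>k\<le>L. q ^ k)" by (simp add: sum_distrib_left)
    also have "\<dots> \<le> C * (1 / (1 - q))"
      using \<open>0 \<le> C\<close> q by (intro mult_left_mono) (auto simp: sum_gp0 divide_right_mono)
    finally have "16 powr p * (e powr p * (\<Sum>k\<le>L. 2 ^ k * real (N k))) \<le> 16 powr p * (C / (1 - q))"
      by (intro mult_left_mono) auto
    moreover have "\<epsilon> powr p = 16 powr p * e powr p"
      using \<epsilon> by (simp add: e_def powr_divide)
    moreover have "\<epsilon> powr p \<le> 1" using \<epsilon> p by (simp add: powr_le1)
    ultimately show ?thesis by (simp add: n_def algebra_simps)
  qed
  ultimately show ?thesis using that by (simp add: q_def)
qed

theorem corollary4p6:
  fixes p :: real
  assumes "separable_space (euclidean :: 'a::banach topology)"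
    and "Sz TYPE('a) = ord_omega"
    and "p > 1"
    and "(SUP \<epsilon>\<in>{0<..<1}.
            ennreal (\<epsilon> powr p) * ennreal_of_enat (enat_of_ord (Sz_eps TYPE('a) \<epsilon>))) < \<infinity>"
  shows "(SUP \<epsilon>\<in>{0<..<1}.
            ennreal (\<epsilon> powr p) * ennreal_of_enat (Cz_eps TYPE('a) \<epsilon>)) < \<infinity>"
proof -
  let ?S = "\<lambda>\<epsilon>. Sz_eps TYPE('a) \<epsilon>"
  obtain C where C: "0 \<le> C"
    "(SUP \<epsilon>\<in>{0<..<1}. ennreal (\<epsilon> powr p) * ennreal_of_enat (enat_of_ord (?S \<epsilon>))) = ennreal C"
    using assms(4)
    by (cases "SUP \<epsilon>\<in>{0<..<1}. ennreal (\<epsilon> powr p) * ennreal_of_enat (enat_of_ord (?S \<epsilon>))") auto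
  have le: "ennreal (\<epsilon> powr p) * ennreal_of_enat (enat_of_ord (?S \<epsilon>)) \<le> ennreal C"
    if "0 < \<epsilon>" "\<epsilon> < 1" for \<epsilon>
    unfolding C(2)[symmetric] using that by (intro SUP_upper) auto
  \<comment> \<open>An infinite index would have \<open>enat_of_ord\<close> value
    \<open>\<infinity>\<close>, and its product with the positive \<open>\<epsilon> powr p\<close>
    would exceed the finite supremum.\<close>
  have fin: "finite {..<?S \<epsilon>}" if "0 < \<epsilon>" "\<epsilon> < 1" for \<epsilon>
  proof (rule ccontr)
    assume "infinite {..<?S \<epsilon>}"
    then show False using le[OF that] that
      by (simp add: enat_of_ord_def ennreal_mult_top top_unique)
  qed
  have bound: "\<epsilon> powr p * real (card {..<?S \<epsilon>}) \<le> C" if "0 < \<epsilon>" "\<epsilon> < 1" for \<epsilon>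
    using le[OF that] fin[OF that] C(1)
    by (simp add: enat_of_ord_def ennreal_of_nat_eq_real_of_nat flip: ennreal_mult)
  define D where "D = 1 + 16 powr p * C / (1 - 2 powr (1 - p))"
  have "(SUP \<epsilon>\<in>{0<..<1}. ennreal (\<epsilon> powr p) * ennreal_of_enat (Cz_eps TYPE('a) \<epsilon>)) \<le> ennreal D"
  proof (rule SUP_least)
    fix \<epsilon> :: real assume "\<epsilon> \<in> {0<..<1}"
    then obtain n where n: "Cz_eps TYPE('a) \<epsilon> \<le> enat n" "\<epsilon> powr p * real n \<le> D"
      using Cz_eps_le[OF assms(3) _ _ fin bound, of \<epsilon>] unfolding D_def by auto
    have "ennreal (\<epsilon> powr p) * ennreal_of_enat (Cz_eps TYPE('a) \<epsilon>)
        \<le> ennreal (\<epsilon> powr p) * ennreal_of_enat (enat n)"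
      using n(1) by (intro mult_left_mono) (auto simp flip: ennreal_of_enat_enat)
    also have "\<dots> = ennreal (\<epsilon> powr p * real n)"
      by (simp add: ennreal_of_nat_eq_real_of_nat ennreal_mult)
    also have "\<dots> \<le> ennreal D" using n(2) by (rule ennreal_leI)
    finally show "ennreal (\<epsilon> powr p) * ennreal_of_enat (Cz_eps TYPE('a) \<epsilon>) \<le> ennreal D" .
  qed
  also have "\<dots> < \<infinity>" by simp
  finally show ?thesis .
qed

end
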